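(* Let $(X,T)$ be a topological dynamical system with zero topological entropy, let $C(X)$ be the set of continuous complex-valued functions on $X$, and let $\mu_{\mathrm{rand}}$ be the random Möbius function, defined on a probability space $(\Omega,\mathbb{P})$. Then there exists a subset $\Omega'\subset\Omega$, independent of $x$ and $f$, such that $\mathbb{P}(\Omega')=1$ and $$\frac1N\sum_{n=1}^{N}f(T^n x)\,\mu_{\mathrm{rand}}(n)(\omega)\longrightarrow 0\quad\text{as }N\to+\infty\qquad \forall\,\omega\in\Omega',\ \forall\, x\in X,\ \forall\, f\in C(X).$$
   Context: A topological dynamical system $(X,T)$ is a compact metric space $(X,d)$ with a homeomorphism $T:X\to X$. For $m\ge1$ let $d_m(x,y)=\max_{0\le k\le m-1}d(T^kx,T^ky)$ and let $r(m,\epsilon)$ be the minimal number of open $d_m$-balls of radius $\epsilon$ needed to cover $X$. The topological entropy is $h(T)=\lim_{\epsilon\to0}\limsup_{m\to+\infty}\frac1m\log r(m,\epsilon)$. Let $\mathcal{Q}$ be the set of square-free positive integers (not divisible by $p^2$ for any prime $p$), and let $(\epsilon_n)_{n\in\mathcal{Q}}$ be independent random variables on $(\Omega,\mathbb{P})$ with $\mathbb{P}(\epsilon_n=1)=\mathbb{P}(\epsilon_n=-1)=\frac12$. The random Möbius function is $\mu_{\mathrm{rand}}(n)=\epsilon_n$ if $n\in\mathcal{Q}$ and $\mu_{\mathrm{rand}}(n)=0$ otherwise. *)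

theory Defs
  imports "HOL-Probability.Probability" "HOL-Computational_Algebra.Squarefree"
begin

text \<open>The compact metric space is a compact subset of a metric type; only the values of \<open>T\<close>
  on \<open>X\<close> matter.\<close>

definition topological_dynamical_system :: "'a::metric_space set \<Rightarrow> ('a \<Rightarrow> 'a) \<Rightarrow> bool" where
  "topological_dynamical_system X T \<longleftrightarrow> compact X \<and> (\<exists>S. homeomorphism X X T S)"

definition bowen_dist :: "('a::metric_space \<Rightarrow> 'a) \<Rightarrow> nat \<Rightarrow> 'a \<Rightarrow> 'a \<Rightarrow> real" where
  "bowen_dist T m x y = (MAX k\<in>{0..m - 1}. dist ((T ^^ k) x) ((T ^^ k) y))"

definition bowen_ball :: "'a::metric_space set \<Rightarrow> ('a \<Rightarrow> 'a) \<Rightarrow> nat \<Rightarrow> real \<Rightarrow> 'a \<Rightarrow> 'a set" where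
  "bowen_ball X T m \<epsilon> x = {y \<in> X. bowen_dist T m x y < \<epsilon>}"

text \<open>For a topological dynamical system and \<open>\<epsilon> > 0\<close> the set of cardinalities below is nonempty
  (lemma \<open>finite_bowen_cover\<close>), so that the infimum is a minimum.\<close>

definition covering_number :: "'a::metric_space set \<Rightarrow> ('a \<Rightarrow> 'a) \<Rightarrow> nat \<Rightarrow> real \<Rightarrow> nat" where
  "covering_number X T m \<epsilon> =
     Inf {card \<B> | \<B>. finite \<B> \<and> \<B> \<subseteq> bowen_ball X T m \<epsilon> ` X \<and> X \<subseteq> \<Union>\<B>}"

text \<open>The entropy may be infinite, hence \<open>ereal\<close>. The limit exists, by lemma
  \<open>tendsto_topological_entropy\<close>. The value of the sequence at \<open>m = 0\<close> does not affect the
  upper limit.\<close>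

definition entropy_at_scale :: "'a::metric_space set \<Rightarrow> ('a \<Rightarrow> 'a) \<Rightarrow> real \<Rightarrow> ereal" where
  "entropy_at_scale X T \<epsilon> =
     limsup (\<lambda>m. ereal (1 / real m * ln (real (covering_number X T m \<epsilon>))))"

definition topological_entropy :: "'a::metric_space set \<Rightarrow> ('a \<Rightarrow> 'a) \<Rightarrow> ereal" where
  "topological_entropy X T = Lim (at_right 0) (entropy_at_scale X T)"

lemma bowen_dist_less_iff:
  "bowen_dist T m x y < \<epsilon> \<longleftrightarrow> (\<forall>k\<in>{0..m - 1}. dist ((T ^^ k) x) ((T ^^ k) y) < \<epsilon>)"
  unfolding bowen_dist_def by (subst Max_less_iff) auto

lemma finite_bowen_cover:
  assumes "topological_dynamical_system X T" "\<epsilon> > 0"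
  shows "\<exists>\<B>. finite \<B> \<and> \<B> \<subseteq> bowen_ball X T m \<epsilon> ` X \<and> X \<subseteq> \<Union>\<B>"
proof -
  have X: "compact X" and T: "continuous_on X T" "T ` X = X"
    using assms(1) by (auto simp: topological_dynamical_system_def homeomorphism_def)
  have iter: "continuous_on X (T ^^ k) \<and> (T ^^ k) ` X \<subseteq> X" for k
  proof (induction k)
    case (Suc k)
    then have "continuous_on X (T \<circ> (T ^^ k))"
      using T(1) by (intro continuous_on_compose) (auto intro: continuous_on_subset)
    with Suc T(2) show ?case by (auto simp: o_def)
  qed simp
  have "\<forall>k. \<exists>\<delta>>0. \<forall>x\<in>X. \<forall>y\<in>X. dist y x < \<delta> \<longrightarrow> dist ((T ^^ k) y) ((T ^^ k) x) < \<epsilon>"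
    using compact_uniformly_continuous[OF conjunct1[OF iter] X] \<open>\<epsilon> > 0\<close>
    unfolding uniformly_continuous_on_def by blast
  then obtain \<delta> where \<delta>: "\<And>k. \<delta> k > 0"
    "\<And>k x y. x \<in> X \<Longrightarrow> y \<in> X \<Longrightarrow> dist y x < \<delta> k \<Longrightarrow> dist ((T ^^ k) y) ((T ^^ k) x) < \<epsilon>"
    by metis
  define d where "d = Min (\<delta> ` {0..m - 1})"
  have d: "d > 0" "\<And>k. k \<in> {0..m - 1} \<Longrightarrow> d \<le> \<delta> k"
    using \<delta>(1) by (auto simp: d_def)
  obtain F where F: "finite F" "F \<subseteq> X" "X \<subseteq> (\<Union>x\<in>F. ball x d)"
    using seq_compact_imp_totally_bounded[OF compact_imp_seq_compact[OF X]] d(1) by metis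
  have "X \<subseteq> \<Union>(bowen_ball X T m \<epsilon> ` F)"
  proof
    fix y assume y: "y \<in> X"
    with F obtain x where x: "x \<in> F" "dist x y < d" by auto
    have "bowen_dist T m x y < \<epsilon>"
      unfolding bowen_dist_less_iff
    proof
      fix k assume "k \<in> {0..m - 1}"
      with x d(2) have "dist x y < \<delta> k" by (meson less_le_trans)
      with \<delta>(2) x(1) F(2) y show "dist ((T ^^ k) x) ((T ^^ k) y) < \<epsilon>" by blast
    qed
    with x(1) y show "y \<in> \<Union>(bowen_ball X T m \<epsilon> ` F)" by (auto simp: bowen_ball_def)
  qed
  moreover have "finite (bowen_ball X T m \<epsilon> ` F)" "bowen_ball X T m \<epsilon> ` F \<subseteq> bowen_ball X T m \<epsilon> ` X"
    using F(1) image_mono[OF F(2)] by simp_all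
  ultimately show ?thesis by blast
qed

lemma covering_number_antimono:
  assumes "topological_dynamical_system X T" "0 < \<epsilon>" "\<epsilon> \<le> \<epsilon>'"
  shows "covering_number X T m \<epsilon>' \<le> covering_number X T m \<epsilon>"
proof -
  let ?C = "\<lambda>e. {card \<B> | \<B>. finite \<B> \<and> \<B> \<subseteq> bowen_ball X T m e ` X \<and> X \<subseteq> \<Union>\<B>}"
  obtain \<A> where "finite \<A>" "\<A> \<subseteq> bowen_ball X T m \<epsilon> ` X" "X \<subseteq> \<Union>\<A>"
    using finite_bowen_cover[OF assms(1,2)] by metis
  then have "card \<A> \<in> ?C \<epsilon>" by (intro CollectI exI[of _ \<A>] conjI refl)
  then have "?C \<epsilon> \<noteq> {}" by (metis empty_iff)
  then have "covering_number X T m \<epsilon> \<in> ?C \<epsilon>"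
    unfolding covering_number_def by (rule Inf_nat_def1)
  then obtain \<B> where B: "covering_number X T m \<epsilon> = card \<B>" "finite \<B>"
    "\<B> \<subseteq> bowen_ball X T m \<epsilon> ` X" "X \<subseteq> \<Union>\<B>" by blast
  then obtain c where c: "\<And>b. b \<in> \<B> \<Longrightarrow> c b \<in> X \<and> b = bowen_ball X T m \<epsilon> (c b)"
    by (metis image_iff subsetD)
  let ?B = "(\<lambda>b. bowen_ball X T m \<epsilon>' (c b)) ` \<B>"
  have sub: "bowen_ball X T m \<epsilon> x \<subseteq> bowen_ball X T m \<epsilon>' x" for x
    using assms(3) by (auto simp: bowen_ball_def)
  have "X \<subseteq> \<Union>?B"
  proof
    fix x assume "x \<in> X"
    then obtain b where "b \<in> \<B>" "x \<in> b" using B(4) by blast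
    then have "x \<in> bowen_ball X T m \<epsilon>' (c b)" using c sub by blast
    with \<open>b \<in> \<B>\<close> show "x \<in> \<Union>?B" by blast
  qed
  moreover have "?B \<subseteq> bowen_ball X T m \<epsilon>' ` X" using c by blast
  ultimately have "card ?B \<in> ?C \<epsilon>'"
    using B(2) by (intro CollectI exI[of _ ?B] conjI refl finite_imageI)
  then have "covering_number X T m \<epsilon>' \<le> card ?B"
    unfolding covering_number_def by (rule cInf_lower) simp
  with card_image_le[OF B(2)] B(1) show ?thesis by (metis order_trans)
qed

lemma entropy_at_scale_antimono:
  assumes "topological_dynamical_system X T" "0 < \<epsilon>" "\<epsilon> \<le> \<epsilon>'"
  shows "entropy_at_scale X T \<epsilon>' \<le> entropy_at_scale X T \<epsilon>"
  unfolding entropy_at_scale_def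
proof (intro Limsup_mono always_eventually allI)
  fix m
  have le: "covering_number X T m \<epsilon>' \<le> covering_number X T m \<epsilon>"
    by (rule covering_number_antimono[OF assms])
  have "ln (real (covering_number X T m \<epsilon>')) \<le> ln (real (covering_number X T m \<epsilon>))"
  proof (cases "covering_number X T m \<epsilon>' = 0")
    case True
    show ?thesis
      by (cases "covering_number X T m \<epsilon> = 0") (use True in auto)
  next
    case False
    with le show ?thesis by simp
  qed
  then show "ereal (1 / real m * ln (real (covering_number X T m \<epsilon>')))
      \<le> ereal (1 / real m * ln (real (covering_number X T m \<epsilon>)))"
    by (subst ereal_less_eq, intro mult_left_mono) simp_all
qed

lemma tendsto_topological_entropy:
  assumes "topological_dynamical_system X T"
  shows "(entropy_at_scale X T \<longlongrightarrow> topological_entropy X T) (at_right 0)"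
proof -
  let ?f = "entropy_at_scale X T"
  have "(?f \<longlongrightarrow> (SUP \<epsilon>\<in>{0<..}. ?f \<epsilon>)) (at_right 0)"
  proof (rule increasing_tendsto)
    show "\<forall>\<^sub>F \<epsilon> in at_right 0. ?f \<epsilon> \<le> (SUP \<epsilon>\<in>{0<..}. ?f \<epsilon>)"
      unfolding eventually_at_right_field by (intro exI[of _ 1]) (auto intro: SUP_upper)
  next
    fix l assume "l < (SUP \<epsilon>\<in>{0<..}. ?f \<epsilon>)"
    then obtain \<epsilon> where e: "\<epsilon> > 0" "l < ?f \<epsilon>" by (auto simp: less_SUP_iff)
    then show "\<forall>\<^sub>F \<delta> in at_right 0. l < ?f \<delta>"
      unfolding eventually_at_right_field
      using entropy_at_scale_antimono[OF assms]
      by (intro exI[of _ \<epsilon>]) (auto intro: less_le_trans)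
  qed
  then show ?thesis
    unfolding topological_entropy_def by (metis tendsto_Lim trivial_limit_at_right_real)
qed

definition squarefree_positive :: "nat set" where
  "squarefree_positive = {n. n > 0 \<and> squarefree n}"

definition mu_rand :: "(nat \<Rightarrow> 'w \<Rightarrow> real) \<Rightarrow> nat \<Rightarrow> 'w \<Rightarrow> real" where
  "mu_rand eps n \<omega> = (if n \<in> squarefree_positive then eps n \<omega> else 0)"

end

theory Submission
  imports Defs
begin

text \<open>For a continuous real \<open>g\<close> bounded by \<open>M\<close>, Hoeffding's inequality bounds the probability
  that \<open>\<bar>\<Sum>n\<le>N. g (T\<^sup>n c) \<mu>(n)\<bar> \<ge> N \<delta>\<close> by \<open>2 exp (- N \<delta>\<^sup>2 / (2 M\<^sup>2))\<close> at each point \<open>c\<close>.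
  Zero entropy makes a subexponential number of points \<open>c\<close> representative for all orbits of
  length \<open>N\<close>, up to an error \<open>\<delta>\<close> in \<open>g\<close>, so Borel-Cantelli applies to the union over these
  points. Finally a countable family of functions coming from partitions of unity spans a dense
  subspace of the continuous functions, hence the exceptional null set can be chosen independently
  of the function.\<close>

section \<open>Orbits and covering numbers\<close>

lemma tds_funpow_mem:
  assumes "topological_dynamical_system X T" "x \<in> X"
  shows "(T ^^ n) x \<in> X"
  using assms by (induction n) (auto simp: topological_dynamical_system_def homeomorphism_def)

text \<open>Turns a minimal cover into a finite set of points of \<open>X\<close>, the form in which
  a union bound can use it. The infimum is attained because finite covers exist.\<close>

lemma covering_number_centers:
  assumes "topological_dynamical_system X T" "\<epsilon> > 0"
  obtains F where "finite F" "F \<subseteq> X" "card F \<le> covering_number X T m \<epsilon>"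
    "\<And>x. x \<in> X \<Longrightarrow> \<exists>c\<in>F. \<forall>k<m. dist ((T ^^ k) c) ((T ^^ k) x) < \<epsilon>"
proof -
  let ?C = "{card \<B> | \<B>. finite \<B> \<and> \<B> \<subseteq> bowen_ball X T m \<epsilon> ` X \<and> X \<subseteq> \<Union>\<B>}"
  have "?C \<noteq> {}"
    using finite_bowen_cover[OF assms, of m] by auto
  then have "covering_number X T m \<epsilon> \<in> ?C"
    unfolding covering_number_def by (rule Inf_nat_def1)
  then obtain \<B> where B: "covering_number X T m \<epsilon> = card \<B>" "finite \<B>"
    "\<B> \<subseteq> bowen_ball X T m \<epsilon> ` X" "X \<subseteq> \<Union>\<B>" by blast
  \<comment> \<open>Different centres can have the same ball; choosing one centre per ball keeps the
    count equal to \<open>card \<B>\<close>.\<close>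
  from B(2,3) obtain F where F: "F \<subseteq> X" "inj_on (bowen_ball X T m \<epsilon>) F"
    "\<B> = bowen_ball X T m \<epsilon> ` F"
    by (meson subset_image_inj)
  show thesis
  proof
    show "finite F"
      using B(2) F(2,3) finite_imageD by blast
    show "card F \<le> covering_number X T m \<epsilon>"
      using F(2,3) B(1) by (simp add: card_image)
    fix x assume "x \<in> X"
    with B(4) F(3) obtain c where "c \<in> F" "bowen_dist T m c x < \<epsilon>"
      by (auto simp: bowen_ball_def)
    then show "\<exists>c\<in>F. \<forall>k<m. dist ((T ^^ k) c) ((T ^^ k) x) < \<epsilon>"
      unfolding bowen_dist_less_iff by (intro bexI[of _ c]) auto
  qed (fact F(1))
qed

text \<open>The entropy at a fixed scale grows as the scale shrinks, so it is bounded by its limit,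
  which is zero. A limit superior below \<open>\<eta>\<close> gives the eventual bound.\<close>

lemma zero_entropy_covering_number:
  assumes tds: "topological_dynamical_system X T" and zero: "topological_entropy X T = 0"
    and "\<epsilon> > 0" "\<eta> > 0"
  shows "\<forall>\<^sub>F m in sequentially. real (covering_number X T m \<epsilon>) \<le> exp (\<eta> * real m)"
proof -
  have "entropy_at_scale X T \<epsilon> \<le> topological_entropy X T"
  proof (rule tendsto_lowerbound[OF tendsto_topological_entropy[OF tds]])
    show "\<forall>\<^sub>F \<delta> in at_right 0. entropy_at_scale X T \<epsilon> \<le> entropy_at_scale X T \<delta>"
      unfolding eventually_at_right_field
      using entropy_at_scale_antimono[OF tds] \<open>\<epsilon> > 0\<close> by (intro exI[of _ \<epsilon>]) auto
  qed simp
  also have "\<dots> < ereal \<eta>"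
    using zero \<open>\<eta> > 0\<close> by simp
  finally have "\<forall>\<^sub>F m in sequentially.
      ereal (1 / real m * ln (real (covering_number X T m \<epsilon>))) < ereal \<eta>"
    unfolding entropy_at_scale_def by (rule Limsup_lessD)
  with eventually_gt_at_top[of 0] show ?thesis
  proof eventually_elim
    case (elim m)
    then have *: "ln (real (covering_number X T m \<epsilon>)) \<le> \<eta> * real m"
      by (simp add: field_simps)
    show ?case
    \<comment> \<open>The value 0 occurs for empty \<open>X\<close>. The logarithm is then only a
      default value, but the claim is trivial since the exponential is positive.\<close>
    proof (cases "covering_number X T m \<epsilon> = 0")
      case False
      with * show ?thesis
        by (metis exp_le_cancel_iff exp_ln of_nat_0_less_iff neq0_conv)
    qed simp
  qed
qed

section \<open>A countable family with dense span\<close>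

text \<open>Normalised tent functions around a finite \<open>d\<close>-net form a partition of
  unity, so the error at \<open>x\<close> is an average of \<open>f x - f p\<close> over net points
  \<open>p\<close> within \<open>d\<close> of \<open>x\<close>. Neither \<open>F\<close> nor
  \<open>\<phi>\<close> depends on \<open>f\<close>.\<close>

lemma partition_of_unity_approximation:
  fixes X :: "'a::metric_space set"
  assumes X: "compact X" and "d > 0"
  shows "\<exists>F \<phi>. finite F \<and> (\<forall>p\<in>F. continuous_on X (\<phi> p)) \<and>
    (\<forall>(f :: 'a \<Rightarrow> 'b::real_normed_vector) \<delta>. \<forall>x\<in>X. (\<forall>p\<in>X. dist x p < d \<longrightarrow> norm (f x - f p) \<le> \<delta>)
      \<longrightarrow> norm (f x - (\<Sum>p\<in>F. \<phi> p x *\<^sub>R f p)) \<le> \<delta>)"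
proof -
  obtain F where F: "finite F" "F \<subseteq> X" "X \<subseteq> (\<Union>p\<in>F. ball p d)"
    using seq_compact_imp_totally_bounded[OF compact_imp_seq_compact[OF X]] \<open>d > 0\<close> by metis
  define s where "s p x = max 0 (d - dist x p)" for p x :: 'a
  have s_nonneg: "s p x \<ge> 0" for p x by (simp add: s_def)
  \<comment> \<open>The net property gives a tent that is positive at \<open>x\<close>, so the
    normalisation below is legitimate.\<close>
  have pos: "(\<Sum>p\<in>F. s p x) > 0" if x: "x \<in> X" for x
  proof -
    obtain p where p: "p \<in> F" "dist p x < d" using F(3) x by auto
    with F(1) show ?thesis
      by (intro sum_pos2[of F p]) (auto simp: s_def dist_commute)
  qed
  define \<phi> where "\<phi> p x = s p x / (\<Sum>q\<in>F. s q x)" for p x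
  show ?thesis
  proof (intro exI conjI ballI allI impI)
    fix p
    have "\<forall>x\<in>X. (\<Sum>q\<in>F. s q x) \<noteq> 0"
      using pos by (metis less_irrefl)
    moreover have "continuous_on X (s q)" for q
      unfolding s_def by (intro continuous_intros)
    ultimately show "continuous_on X (\<phi> p)"
      unfolding \<phi>_def by (intro continuous_on_divide continuous_on_sum)
  next
    fix f :: "'a \<Rightarrow> 'b" and \<delta> x
    assume x: "x \<in> X" and f: "\<forall>p\<in>X. dist x p < d \<longrightarrow> norm (f x - f p) \<le> \<delta>"
    have sum1: "(\<Sum>p\<in>F. \<phi> p x) = 1"
      using pos[OF x] by (simp add: \<phi>_def flip: sum_divide_distrib)
    have "f x - (\<Sum>p\<in>F. \<phi> p x *\<^sub>R f p) = (\<Sum>p\<in>F. \<phi> p x *\<^sub>R (f x - f p))"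
      by (simp add: scaleR_diff_right sum_subtractf sum1 flip: scaleR_left.sum)
    also have "norm \<dots> \<le> (\<Sum>p\<in>F. \<phi> p x * \<delta>)"
    proof (rule sum_norm_le)
      fix p assume p: "p \<in> F"
      have nn: "\<phi> p x \<ge> 0" using pos[OF x] s_nonneg by (simp add: \<phi>_def)
      show "norm (\<phi> p x *\<^sub>R (f x - f p)) \<le> \<phi> p x * \<delta>"
      proof (cases "dist x p < d")
        case True
        with f p F(2) nn show ?thesis
          by (auto intro!: mult_left_mono)
      next
        case False
        then have "\<phi> p x = 0" by (simp add: \<phi>_def s_def)
        then show ?thesis by simp
      qed
    qed
    also have "\<dots> = \<delta>" by (simp add: sum1 flip: sum_distrib_right)
    finally show "norm (f x - (\<Sum>p\<in>F. \<phi> p x *\<^sub>R f p)) \<le> \<delta>" .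
  qed (fact F(1))
qed

text \<open>Collects the finite partitions of unity at the scales \<open>1 / Suc k\<close>; uniform
  continuity of \<open>f\<close> selects the scale. The coefficients \<open>f p\<close> are
  arbitrary vectors: only the functions they multiply have to form a countable set.\<close>

lemma countable_spanning_family:
  fixes X :: "'a::metric_space set"
  assumes X: "compact X"
  obtains G :: "('a \<Rightarrow> real) set" where "countable G" "\<And>g. g \<in> G \<Longrightarrow> continuous_on X g"
    "\<And>(f :: 'a \<Rightarrow> 'b::real_normed_vector) \<delta>. \<lbrakk>continuous_on X f; \<delta> > 0\<rbrakk> \<Longrightarrow>
      \<exists>F \<phi>. finite F \<and> \<phi> ` F \<subseteq> G \<and> (\<forall>x\<in>X. norm (f x - (\<Sum>p\<in>F. \<phi> p x *\<^sub>R f p)) \<le> \<delta>)"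
proof -
  define Q where "Q d F \<phi> \<longleftrightarrow> finite F \<and> (\<forall>p\<in>F. continuous_on X (\<phi> p)) \<and>
      (\<forall>(f :: 'a \<Rightarrow> 'b) \<delta>. \<forall>x\<in>X. (\<forall>p\<in>X. dist x p < d \<longrightarrow> norm (f x - f p) \<le> \<delta>)
        \<longrightarrow> norm (f x - (\<Sum>p\<in>F. \<phi> p x *\<^sub>R f p)) \<le> \<delta>)" for d F and \<phi> :: "'a \<Rightarrow> 'a \<Rightarrow> real"
  have "\<exists>F \<phi>. Q (1 / real (Suc k)) F \<phi>" for k
    unfolding Q_def by (rule partition_of_unity_approximation[OF X]) simp
  then obtain F \<phi> where Q: "\<And>k. Q (1 / real (Suc k)) (F k) (\<phi> k)"
    by metis
  then have F: "\<And>k. finite (F k)" "\<And>k p. p \<in> F k \<Longrightarrow> continuous_on X (\<phi> k p)"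
    by (simp_all add: Q_def)
  show thesis
  proof
    show "countable (\<Union>k. \<phi> k ` F k)"
      using F(1) by (simp add: countable_finite)
    show "continuous_on X g" if "g \<in> (\<Union>k. \<phi> k ` F k)" for g
      using that F(2) by auto
    fix f :: "'a \<Rightarrow> 'b" and \<delta> :: real
    assume f: "continuous_on X f" and "\<delta> > 0"
    then obtain d where d: "d > 0"
      "\<And>x y. \<lbrakk>x \<in> X; y \<in> X; dist y x < d\<rbrakk> \<Longrightarrow> dist (f y) (f x) < \<delta>"
      using compact_uniformly_continuous[OF f X] unfolding uniformly_continuous_on_def by metis
    obtain k where k: "1 / real (Suc k) < d"
      using nat_approx_posE[OF \<open>d > 0\<close>] by blast
    have "norm (f x - (\<Sum>p\<in>F k. \<phi> k p x *\<^sub>R f p)) \<le> \<delta>" if x: "x \<in> X" for x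
    proof -
      have "norm (f x - f p) \<le> \<delta>" if "p \<in> X" "dist x p < 1 / Suc k" for p
        using d(2)[of p x] that x k by (simp add: dist_norm)
      with Q[of k] x show ?thesis unfolding Q_def by blast
    qed
    with F(1) show "\<exists>F' \<phi>'. finite F' \<and> \<phi>' ` F' \<subseteq> (\<Union>k. \<phi> k ` F k) \<and>
        (\<forall>x\<in>X. norm (f x - (\<Sum>p\<in>F'. \<phi>' p x *\<^sub>R f p)) \<le> \<delta>)"
      by (intro exI[of _ "F k"] exI[of _ "\<phi> k"]) auto
  qed
qed

section \<open>Random Moebius sums\<close>

locale random_moebius = prob_space P for P :: "'w measure" +
  fixes eps :: "nat \<Rightarrow> 'w \<Rightarrow> real"
  assumes indep_eps: "indep_vars (\<lambda>_. borel) eps squarefree_positive"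
    and prob_eps_1: "n \<in> squarefree_positive \<Longrightarrow> prob {\<omega> \<in> space P. eps n \<omega> = 1} = 1 / 2"
    and prob_eps_m1: "n \<in> squarefree_positive \<Longrightarrow> prob {\<omega> \<in> space P. eps n \<omega> = -1} = 1 / 2"
begin

lemma measurable_eps:
  "n \<in> squarefree_positive \<Longrightarrow> eps n \<in> borel_measurable P"
  using indep_eps by (simp add: indep_vars_def)

lemma measurable_mu_rand [measurable]: "mu_rand eps n \<in> borel_measurable P"
  by (cases "n \<in> squarefree_positive")
     (auto simp: mu_rand_def[abs_def] measurable_eps)

text \<open>The two events are disjoint and their probabilities add up to 1. Other values remain
  possible on a null set, so bounds on \<open>mu_rand\<close> hold only almost everywhere.\<close>

lemma AE_eps:
  assumes n: "n \<in> squarefree_positive"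
  shows "AE \<omega> in P. eps n \<omega> = 1 \<or> eps n \<omega> = -1"
proof -
  note [measurable] = measurable_eps[OF n]
  have "prob ({\<omega> \<in> space P. eps n \<omega> = 1} \<union> {\<omega> \<in> space P. eps n \<omega> = -1}) = 1 / 2 + 1 / 2"
    using prob_eps_1[OF n] prob_eps_m1[OF n] by (subst finite_measure_Union) auto
  then have "AE \<omega> in P. \<omega> \<in> {\<omega> \<in> space P. eps n \<omega> = 1} \<union> {\<omega> \<in> space P. eps n \<omega> = -1}"
    by (intro AE_prob_1) simp
  then show ?thesis by eventually_elim auto
qed

lemma AE_mu_rand_le_1: "AE \<omega> in P. \<forall>n. \<bar>mu_rand eps n \<omega>\<bar> \<le> 1"
  unfolding AE_all_countable
proof
  fix n
  show "AE \<omega> in P. \<bar>mu_rand eps n \<omega>\<bar> \<le> 1"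
  proof (cases "n \<in> squarefree_positive")
    case True
    from AE_eps[OF this] show ?thesis by eventually_elim (auto simp: mu_rand_def)
  qed (simp add: mu_rand_def)
qed

lemma expectation_eps:
  assumes n: "n \<in> squarefree_positive"
  shows "expectation (eps n) = 0"
proof -
  note [measurable] = measurable_eps[OF n]
  let ?A = "{\<omega> \<in> space P. eps n \<omega> = 1}" and ?B = "{\<omega> \<in> space P. eps n \<omega> = -1}"
  have "expectation (eps n) = expectation (\<lambda>\<omega>. indicator ?A \<omega> - indicator ?B \<omega>)"
  proof (rule integral_cong_AE)
    show "AE \<omega> in P. eps n \<omega> = indicator ?A \<omega> - indicator ?B \<omega>"
      using AE_eps[OF n] AE_space by eventually_elim (auto simp: indicator_def)
  qed measurable
  also have "\<dots> = prob ?A - prob ?B"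
    by (subst Bochner_Integration.integral_diff) (auto simp: Int_absorb1 less_top[symmetric])
  also have "\<dots> = 0" by (simp add: prob_eps_1[OF n] prob_eps_m1[OF n])
  finally show ?thesis .
qed

text \<open>Hoeffding's inequality for the independent centred variables \<open>a n * eps n\<close>
  with values in \<open>{- M..M}\<close>, where \<open>n\<close> runs over the square-free numbers
  up to \<open>N\<close>.\<close>

lemma mu_rand_sum_tail:
  assumes a: "\<And>n. \<bar>a n\<bar> \<le> M" and M: "M > 0" and t: "t \<ge> 0" and N: "N > 0"
  shows "prob {\<omega> \<in> space P. \<bar>\<Sum>n=1..N. a n * mu_rand eps n \<omega>\<bar> \<ge> t}
           \<le> 2 * exp (- t\<^sup>2 / (2 * M\<^sup>2 * real N))"
proof -
  define I where "I = {1..N} \<inter> squarefree_positive"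
  \<comment> \<open>Since 1 is square-free, \<open>I\<close> is nonempty and the denominators below
    are positive.\<close>
  have I: "finite I" "1 \<in> I" "card I \<le> N"
    using N card_mono[of "{1..N}" I] by (auto simp: I_def squarefree_positive_def)
  then have cI: "card I > 0" by (auto simp: card_gt_0_iff)
  have mean: "expectation (\<lambda>\<omega>. a n * eps n \<omega>) = 0" if "n \<in> I" for n
    using that expectation_eps[of n] by (simp add: I_def)
  interpret H: Hoeffding_ineq P I "\<lambda>n \<omega>. a n * eps n \<omega>" "\<lambda>_. - M" "\<lambda>_. M" 0
  proof unfold_locales
    have "indep_vars (\<lambda>_. borel) eps I"
      by (rule indep_vars_subset[OF indep_eps]) (simp add: I_def)
    then show "indep_vars (\<lambda>_. borel) (\<lambda>n \<omega>. a n * eps n \<omega>) I"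
      by (rule indep_vars_compose2) simp
    fix n assume "n \<in> I"
    then have "AE \<omega> in P. eps n \<omega> = 1 \<or> eps n \<omega> = -1" by (intro AE_eps) (simp add: I_def)
    then show "AE \<omega> in P. a n * eps n \<omega> \<in> {- M..M}"
      by eventually_elim (use a[of n] in auto)
  next
    show "0 \<equiv> \<Sum>n\<in>I. expectation (\<lambda>\<omega>. a n * eps n \<omega>)"
      by (rule eq_reflection, rule sym, rule sum.neutral) (use mean in blast)
  qed (fact I)
  have "(\<Sum>n=1..N. a n * mu_rand eps n \<omega>) = (\<Sum>n\<in>I. a n * eps n \<omega>)" for \<omega>
    by (auto simp: I_def mu_rand_def sum.inter_restrict intro!: sum.cong)
  then have "prob {\<omega> \<in> space P. \<bar>\<Sum>n=1..N. a n * mu_rand eps n \<omega>\<bar> \<ge> t}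
      \<le> 2 * exp (- 2 * t\<^sup>2 / (\<Sum>n\<in>I. (M - - M)\<^sup>2))"
    using H.Hoeffding_ineq_abs_ge[OF t] cI M by simp
  also have "\<dots> = 2 * exp (- (t\<^sup>2 / (2 * M\<^sup>2 * real (card I))))"
    using cI M by (simp add: power2_eq_square field_simps)
  \<comment> \<open>Replacing \<open>card I\<close> by the larger \<open>N\<close> only weakens the
    bound.\<close>
  also have "\<dots> \<le> 2 * exp (- (t\<^sup>2 / (2 * M\<^sup>2 * real N)))"
    using cI M I(3) by (auto intro!: divide_left_mono mult_left_mono mult_pos_pos)
  finally show ?thesis by simp
qed

section \<open>Almost sure bounds, uniform over all orbits\<close>

text \<open>One \<open>\<delta>\<close> comes from the tail bound at a Bowen centre, the other from
  moving an arbitrary \<open>x\<close> to a centre shadowing its orbit. Neither the null set nor the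
  threshold for \<open>N\<close> depends on \<open>x\<close>.\<close>

lemma AE_mu_rand_sum_small:
  fixes g :: "'a::metric_space \<Rightarrow> real"
  assumes tds: "topological_dynamical_system X T" and zero: "topological_entropy X T = 0"
    and g: "continuous_on X g" and \<delta>: "\<delta> > 0"
  shows "AE \<omega> in P. \<forall>\<^sub>F N in sequentially. \<forall>x\<in>X.
           \<bar>\<Sum>n=1..N. g ((T ^^ n) x) * mu_rand eps n \<omega>\<bar> \<le> 2 * \<delta> * real N"
proof -
  have X: "compact X" using tds by (simp add: topological_dynamical_system_def)
  obtain M where M: "M > 0" "\<And>x. x \<in> X \<Longrightarrow> \<bar>g x\<bar> \<le> M"
    using compact_imp_bounded[OF compact_continuous_image[OF g X]]
    by (auto simp: bounded_pos)
  obtain \<epsilon> where \<epsilon>: "\<epsilon> > 0" "\<And>x y. \<lbrakk>x \<in> X; y \<in> X; dist y x < \<epsilon>\<rbrakk> \<Longrightarrow> dist (g y) (g x) < \<delta>"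
    using compact_uniformly_continuous[OF g X] \<delta> unfolding uniformly_continuous_on_def by metis
  \<comment> \<open>The sums use the iterates 1 to \<open>N\<close>, so shadowing must last for
    \<open>Suc N\<close> steps, counted from 0.\<close>
  have "\<forall>N. \<exists>F. finite F \<and> F \<subseteq> X \<and> card F \<le> covering_number X T (Suc N) \<epsilon> \<and>
      (\<forall>x\<in>X. \<exists>c\<in>F. \<forall>k<Suc N. dist ((T ^^ k) c) ((T ^^ k) x) < \<epsilon>)"
    by (meson covering_number_centers[OF tds \<epsilon>(1)])
  then obtain F where F: "\<And>N. finite (F N)" "\<And>N. F N \<subseteq> X"
    "\<And>N. card (F N) \<le> covering_number X T (Suc N) \<epsilon>"
    "\<And>N x. x \<in> X \<Longrightarrow> \<exists>c\<in>F N. \<forall>k<Suc N. dist ((T ^^ k) c) ((T ^^ k) x) < \<epsilon>"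
    by metis
  \<comment> \<open>Chosen so that the Hoeffding exponent is \<open>- 2 * \<eta> * N\<close>: one
    half absorbs the growth of the number of centres, the other remains as decay.\<close>
  define \<eta> where "\<eta> = \<delta>\<^sup>2 / (4 * M\<^sup>2)"
  have \<eta>: "\<eta> > 0" using \<delta> M(1) by (simp add: \<eta>_def)
  define S where "S N c \<omega> = (\<Sum>n=1..N. g ((T ^^ n) c) * mu_rand eps n \<omega>)" for N c \<omega>
  define B where "B N c = {\<omega> \<in> space P. \<bar>S N c \<omega>\<bar> \<ge> \<delta> * real N}" for N c
  have B_meas: "B N c \<in> sets P" for N c
    unfolding B_def S_def by measurable
  have B_le: "prob (B N c) \<le> 2 * exp (- 2 * \<eta> * real N)" if "N > 0" "c \<in> X" for N c
  proof -
    have "prob (B N c) \<le> 2 * exp (- (\<delta> * real N)\<^sup>2 / (2 * M\<^sup>2 * real N))"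
      unfolding B_def S_def
      by (intro mu_rand_sum_tail M tds_funpow_mem[OF tds] that) (use \<delta> in auto)
    also have "- (\<delta> * real N)\<^sup>2 / (2 * M\<^sup>2 * real N) = - 2 * \<eta> * real N"
      using that M(1) by (simp add: \<eta>_def power2_eq_square field_simps)
    finally show ?thesis .
  qed
  define A where "A N = (\<Union>c\<in>F N. B N c)" for N
  have A_meas: "A N \<in> sets P" for N
    unfolding A_def using F(1) B_meas by (intro sets.finite_UN) auto
  have "\<forall>\<^sub>F N in sequentially. real (covering_number X T (Suc N) \<epsilon>) \<le> exp (\<eta> * real (Suc N))"
    using zero_entropy_covering_number[OF tds zero \<epsilon>(1) \<eta>]
    by (subst eventually_sequentially_Suc)
  then have "\<forall>\<^sub>F N in sequentially. norm (prob (A N)) \<le> 2 * exp \<eta> * exp (- \<eta>) ^ N"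
    using eventually_gt_at_top[of 0]
  proof eventually_elim
    case (elim N)
    have "prob (A N) \<le> (\<Sum>c\<in>F N. prob (B N c))"
      unfolding A_def using F(1) B_meas by (intro finite_measure_subadditive_finite) auto
    also have "\<dots> \<le> real (card (F N)) * (2 * exp (- 2 * \<eta> * real N))"
      using B_le elim F(2) by (intro sum_bounded_above) blast
    also have "\<dots> \<le> exp (\<eta> * real (Suc N)) * (2 * exp (- 2 * \<eta> * real N))"
      using elim F(3)[of N] by (intro mult_right_mono) auto
    also have "\<dots> = 2 * exp (\<eta> * real (Suc N) + - 2 * \<eta> * real N)"
      by (simp only: exp_add mult.left_commute)
    \<comment> \<open>What is left is a geometric sequence of ratio
      \<open>exp (- \<eta>) < 1\<close>, hence summable.\<close>
    also have "\<eta> * real (Suc N) + - 2 * \<eta> * real N = \<eta> + real N * (- \<eta>)"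
      by (simp add: algebra_simps)
    also have "2 * exp \<dots> = 2 * exp \<eta> * exp (- \<eta>) ^ N"
      by (simp only: exp_add exp_of_nat_mult mult.assoc)
    finally show ?case by simp
  qed
  moreover have "summable (\<lambda>N. 2 * exp \<eta> * exp (- \<eta>) ^ N)"
    using \<eta> by (intro summable_mult summable_geometric) simp
  ultimately have "summable (\<lambda>N. prob (A N))"
    by (rule summable_comparison_test_ev)
  \<comment> \<open>Borel-Cantelli: almost surely only finitely many of the bad events
    \<open>A N\<close> occur.\<close>
  then have "AE \<omega> in P. \<forall>\<^sub>F N in sequentially. \<omega> \<in> space P - A N"
    using A_meas by (intro borel_cantelli_AE1) (auto simp: less_top[symmetric])
  with AE_mu_rand_le_1 show ?thesis
  proof eventually_elim
    case (elim \<omega>)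
    from elim(2) show ?case
    proof eventually_elim
      case (elim N)
      show ?case
      proof
        fix x assume x: "x \<in> X"
        then obtain c where c: "c \<in> F N" "\<forall>k<Suc N. dist ((T ^^ k) c) ((T ^^ k) x) < \<epsilon>"
          using F(4) by blast
        then have cX: "c \<in> X" using F(2) by blast
        \<comment> \<open>Each term is at most \<open>\<delta>\<close>, by the shadowing, the choice
          of \<open>\<epsilon>\<close> and the bound 1 on \<open>mu_rand\<close>.\<close>
        have "S N x \<omega> - S N c \<omega>
            = (\<Sum>n=1..N. (g ((T ^^ n) x) - g ((T ^^ n) c)) * mu_rand eps n \<omega>)"
          by (simp add: S_def sum_subtractf algebra_simps)
        also have "norm \<dots> \<le> (\<Sum>n=1..N. \<delta>)"
        proof (rule sum_norm_le)
          fix n assume "n \<in> {1..N}"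
          then have "dist (g ((T ^^ n) c)) (g ((T ^^ n) x)) < \<delta>"
            using c by (intro \<epsilon>(2) tds_funpow_mem[OF tds] x cX) auto
          then have "\<bar>g ((T ^^ n) x) - g ((T ^^ n) c)\<bar> * \<bar>mu_rand eps n \<omega>\<bar> \<le> \<delta> * 1"
            using \<open>\<forall>n. \<bar>mu_rand eps n \<omega>\<bar> \<le> 1\<close> \<delta>
            by (intro mult_mono) (auto simp: dist_real_def)
          then show "norm ((g ((T ^^ n) x) - g ((T ^^ n) c)) * mu_rand eps n \<omega>) \<le> \<delta>"
            by (simp add: abs_mult)
        qed
        finally have "\<bar>S N x \<omega> - S N c \<omega>\<bar> \<le> \<delta> * real N" by (simp add: mult.commute)
        moreover have "\<bar>S N c \<omega>\<bar> < \<delta> * real N"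
          using elim c(1) by (auto simp: A_def B_def)
        ultimately have "\<bar>S N x \<omega>\<bar> \<le> 2 * \<delta> * real N" by linarith
        then show "\<bar>\<Sum>n=1..N. g ((T ^^ n) x) * mu_rand eps n \<omega>\<bar> \<le> 2 * \<delta> * real N"
          by (simp add: S_def)
      qed
    qed
  qed
qed

lemma AE_mu_rand_average_real:
  fixes g :: "'a::metric_space \<Rightarrow> real"
  assumes tds: "topological_dynamical_system X T" and zero: "topological_entropy X T = 0"
    and g: "continuous_on X g"
  shows "AE \<omega> in P. \<forall>x\<in>X.
           (\<lambda>N. 1 / real N * (\<Sum>n=1..N. g ((T ^^ n) x) * mu_rand eps n \<omega>)) \<longlonglongrightarrow> 0"
proof -
  \<comment> \<open>Countably many tolerances \<open>1 / Suc k\<close> suffice for the limit, so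
    their null sets can be united.\<close>
  have "AE \<omega> in P. \<forall>k::nat. \<forall>\<^sub>F N in sequentially. \<forall>x\<in>X.
      \<bar>\<Sum>n=1..N. g ((T ^^ n) x) * mu_rand eps n \<omega>\<bar> \<le> 2 * (1 / real (Suc k)) * real N"
    unfolding AE_all_countable
    by (intro allI AE_mu_rand_sum_small[OF tds zero g]) simp
  then show ?thesis
  proof eventually_elim
    case (elim \<omega>)
    show ?case
    proof
      fix x assume x: "x \<in> X"
      show "(\<lambda>N. 1 / real N * (\<Sum>n=1..N. g ((T ^^ n) x) * mu_rand eps n \<omega>)) \<longlonglongrightarrow> 0"
      proof (rule tendstoI)
        fix e :: real assume "e > 0"
        then obtain k where k: "1 / real (Suc k) < e / 2"
          using nat_approx_posE[of "e / 2"] by auto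
        from elim[rule_format, of k] eventually_gt_at_top[of 0]
        show "\<forall>\<^sub>F N in sequentially.
            dist (1 / real N * (\<Sum>n=1..N. g ((T ^^ n) x) * mu_rand eps n \<omega>)) 0 < e"
        proof eventually_elim
          case (elim N)
          have "\<bar>\<Sum>n=1..N. g ((T ^^ n) x) * mu_rand eps n \<omega>\<bar> \<le> 2 * (1 / real (Suc k)) * real N"
            using elim x by blast
          also have "\<dots> < e * real N"
            using k elim by (intro mult_strict_right_mono) auto
          finally show ?case
            using elim by (simp add: abs_mult field_simps)
        qed
      qed
    qed
  qed
qed

end

section \<open>From the countable family to all continuous functions\<close>

text \<open>Purely deterministic, at fixed \<open>\<omega>\<close> and \<open>x\<close>: the
  averages are linear in \<open>f\<close> and, as \<open>mu_rand\<close> is bounded by 1, do not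
  exceed its supremum norm on \<open>X\<close>. Convergence to 0 thus passes from the span of
  \<open>G\<close> to its uniform limits.\<close>

lemma mu_rand_average_approx:
  fixes f :: "'a::metric_space \<Rightarrow> complex"
  assumes tds: "topological_dynamical_system X T" and x: "x \<in> X"
    and mu: "\<And>n. \<bar>mu_rand eps n \<omega>\<bar> \<le> 1"
    and approx: "\<And>\<delta>. \<delta> > 0 \<Longrightarrow>
      \<exists>F \<phi>. finite F \<and> \<phi> ` F \<subseteq> G \<and> (\<forall>x\<in>X. norm (f x - (\<Sum>p\<in>F. \<phi> p x *\<^sub>R f p)) \<le> \<delta>)"
    and G: "\<And>g. g \<in> G \<Longrightarrow>
      (\<lambda>N. 1 / real N * (\<Sum>n=1..N. g ((T ^^ n) x) * mu_rand eps n \<omega>)) \<longlonglongrightarrow> 0"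
  shows "(\<lambda>N. 1 / of_nat N * (\<Sum>n=1..N. f ((T ^^ n) x) * of_real (mu_rand eps n \<omega>))) \<longlonglongrightarrow> 0"
proof (rule tendstoI)
  fix e :: real assume "e > 0"
  then obtain F \<phi> where F: "finite F" "\<phi> ` F \<subseteq> G"
    "\<And>x. x \<in> X \<Longrightarrow> norm (f x - (\<Sum>p\<in>F. \<phi> p x *\<^sub>R f p)) \<le> e / 2"
    using approx[of "e / 2"] by auto
  define h where "h y = (\<Sum>p\<in>F. \<phi> p y *\<^sub>R f p)" for y
  define avg :: "('a \<Rightarrow> complex) \<Rightarrow> nat \<Rightarrow> complex" where
    "avg u N = 1 / of_nat N * (\<Sum>n=1..N. u ((T ^^ n) x) * of_real (mu_rand eps n \<omega>))" for u N
  \<comment> \<open>Exchanging the sums writes the average of \<open>h\<close> as a fixed finite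
    combination, with complex coefficients \<open>f p\<close>, of real averages covered by the
    assumption on \<open>G\<close>.\<close>
  have avg_h: "avg h N = (\<Sum>p\<in>F. of_real (1 / real N * (\<Sum>n=1..N. \<phi> p ((T ^^ n) x) * mu_rand eps n \<omega>)) * f p)"
    for N
    unfolding avg_def h_def of_real_mult of_real_sum sum_distrib_left sum_distrib_right
    by (subst sum.swap) (simp add: scaleR_conv_of_real mult_ac)
  have "(\<lambda>N. \<Sum>p\<in>F. of_real (1 / real N * (\<Sum>n=1..N. \<phi> p ((T ^^ n) x) * mu_rand eps n \<omega>)) * f p)
      \<longlonglongrightarrow> (\<Sum>p\<in>F. of_real 0 * f p)"
    using F(2) by (intro tendsto_sum tendsto_mult tendsto_of_real G tendsto_const) auto
  then have "avg h \<longlonglongrightarrow> 0" unfolding avg_h[symmetric] by simp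
  then have "\<forall>\<^sub>F N in sequentially. dist (avg h N) 0 < e / 2"
    using \<open>e > 0\<close> by (intro tendstoD) auto
  with eventually_gt_at_top[of 0]
  have "\<forall>\<^sub>F N in sequentially. dist (avg f N) 0 < e"
  proof eventually_elim
    case (elim N)
    \<comment> \<open>The approximation contributes at most \<open>e / 2\<close> for every positive
      \<open>N\<close>; the average of \<open>h\<close> supplies the other half eventually.\<close>
    have "avg f N - avg h N
        = 1 / of_nat N * (\<Sum>n=1..N. (f ((T ^^ n) x) - h ((T ^^ n) x)) * of_real (mu_rand eps n \<omega>))"
      by (simp add: avg_def left_diff_distrib sum_subtractf right_diff_distrib)
    also have "norm \<dots> \<le> 1 / real N * (\<Sum>n=1..N. e / 2)"
      unfolding norm_mult norm_divide norm_of_nat norm_one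
    proof (intro mult_left_mono sum_norm_le)
      fix n
      have "norm (f ((T ^^ n) x) - h ((T ^^ n) x)) * \<bar>mu_rand eps n \<omega>\<bar> \<le> e / 2 * 1"
        unfolding h_def
        using mu \<open>e > 0\<close> by (intro mult_mono F(3) tds_funpow_mem[OF tds x]) auto
      then show "norm ((f ((T ^^ n) x) - h ((T ^^ n) x)) * of_real (mu_rand eps n \<omega>)) \<le> e / 2"
        by (simp add: norm_mult)
    qed simp
    also have "\<dots> = e / 2" using elim by simp
    finally show ?case
      using elim norm_triangle_sub[of "avg f N" "avg h N"] by simp
  qed
  then show "\<forall>\<^sub>F N in sequentially.
      dist (1 / of_nat N * (\<Sum>n=1..N. f ((T ^^ n) x) * of_real (mu_rand eps n \<omega>))) 0 < e"
    by (simp add: avg_def)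
qed

theorem theorem2p10:
  fixes X :: "'a::metric_space set" and T :: "'a \<Rightarrow> 'a"
    and P :: "'w measure" and eps :: "nat \<Rightarrow> 'w \<Rightarrow> real"
  assumes "topological_dynamical_system X T"
    and "topological_entropy X T = 0"
    and "prob_space P"
    and "prob_space.indep_vars P (\<lambda>_. borel) eps squarefree_positive"
    and "\<And>n. n \<in> squarefree_positive \<Longrightarrow> measure P {\<omega> \<in> space P. eps n \<omega> = 1} = 1 / 2"
    and "\<And>n. n \<in> squarefree_positive \<Longrightarrow> measure P {\<omega> \<in> space P. eps n \<omega> = -1} = 1 / 2"
  shows "\<exists>\<Omega>'. \<Omega>' \<in> sets P \<and> measure P \<Omega>' = 1 \<and>
    (\<forall>\<omega>\<in>\<Omega>'. \<forall>x\<in>X. \<forall>f :: 'a \<Rightarrow> complex. continuous_on X f \<longrightarrow>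
      (\<lambda>N. 1 / of_nat N * (\<Sum>n=1..N. f ((T ^^ n) x) * of_real (mu_rand eps n \<omega>)))
        \<longlonglongrightarrow> 0)"
proof -
  interpret prob_space P by fact
  interpret random_moebius P eps by unfold_locales (fact assms)+
  have "compact X" using assms(1) by (simp add: topological_dynamical_system_def)
  then obtain G where G: "countable G" "\<And>g. g \<in> G \<Longrightarrow> continuous_on X g"
    "\<And>(f :: 'a \<Rightarrow> complex) \<delta>. \<lbrakk>continuous_on X f; \<delta> > 0\<rbrakk> \<Longrightarrow>
      \<exists>F \<phi>. finite F \<and> \<phi> ` F \<subseteq> G \<and> (\<forall>x\<in>X. norm (f x - (\<Sum>p\<in>F. \<phi> p x *\<^sub>R f p)) \<le> \<delta>)"
    by (rule countable_spanning_family[where 'b=complex]) blast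
  \<comment> \<open>Countability of \<open>G\<close> yields a single null set. The uncountably many
    \<open>f\<close> enter only afterwards, at a fixed \<open>\<omega>\<close>.\<close>
  have "AE \<omega> in P. \<forall>g\<in>G. \<forall>x\<in>X.
      (\<lambda>N. 1 / real N * (\<Sum>n=1..N. g ((T ^^ n) x) * mu_rand eps n \<omega>)) \<longlonglongrightarrow> 0"
    unfolding AE_ball_countable[OF G(1)]
    using AE_mu_rand_average_real[OF assms(1,2) G(2)] by blast
  with AE_mu_rand_le_1 have "AE \<omega> in P. \<forall>x\<in>X. \<forall>f :: 'a \<Rightarrow> complex. continuous_on X f \<longrightarrow>
      (\<lambda>N. 1 / of_nat N * (\<Sum>n=1..N. f ((T ^^ n) x) * of_real (mu_rand eps n \<omega>))) \<longlonglongrightarrow> 0"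
  proof eventually_elim
    case (elim \<omega>)
    then show ?case
      by (intro ballI allI impI mu_rand_average_approx[OF assms(1), where G = G] G(3)) auto
  qed
  \<comment> \<open>The almost everywhere statement yields a measurable set of full probability on
    which it holds.\<close>
  then obtain \<Omega>' where "\<Omega>' \<in> sets P" "prob \<Omega>' = 1"
    "\<forall>\<omega>\<in>\<Omega>'. \<forall>x\<in>X. \<forall>f :: 'a \<Rightarrow> complex. continuous_on X f \<longrightarrow>
      (\<lambda>N. 1 / of_nat N * (\<Sum>n=1..N. f ((T ^^ n) x) * of_real (mu_rand eps n \<omega>))) \<longlonglongrightarrow> 0"
    by (rule AE_E_prob) blast
  then show ?thesis by blast
qed

end
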